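(* Let $S=K[x_1,\ldots,x_n]$ be a standard graded polynomial ring over a field $K$ and let $I\subset S$ be a nonzero proper graded ideal. Then for every $\mathfrak{p}\in\operatorname{Ass}(I)$ we have $\mathrm{v}_{\mathfrak{p}}(I)\geq\alpha(I)-\alpha(\mathfrak{p})$, and hence $\mathrm{v}(I)\geq \alpha(I)-c(I)$. Moreover, if all the associated primes of $I$ are generated by linear forms (for example, if $I$ is a monomial ideal), then $\mathrm{v}_{\mathfrak{p}}(I)\geq \mathrm{v}(I)\geq \alpha(I)-1$ for all $\mathfrak{p}\in\operatorname{Ass}(I)$.
   Context: $S=\bigoplus_{d\ge 0}S_d$ is graded with $\deg x_i=1$. $\operatorname{Ass}(I)$ denotes the set of associated primes of $I$ (i.e. of the $S$-module $S/I$). For a nonzero graded ideal $I$, $\alpha(I):=\min\{\deg(f)\mid f\in I\setminus\{0\}\}$ (minimum over homogeneous $f$). $c(I):=\max\{\alpha(\mathfrak{p})\mid \mathfrak{p}\in\operatorname{Ass}(I)\}$. For a proper graded ideal $I$ and $\mathfrak{p}\in\operatorname{Ass}(I)$, the local v-number is $\mathrm{v}_{\mathfrak{p}}(I):=\min\{d\geq 0\mid \exists f\in S_d \text{ with } (I:f)=\mathfrak{p}\}$, and the v-number is $\mathrm{v}(I):=\min\{d\geq 0\mid \exists f\in S_d \text{ and } \mathfrak{p}\in\operatorname{Ass}(I)\text{ with }(I:f)=\mathfrak{p}\}=\min_{\mathfrak p\in\operatorname{Ass}(I)}\mathrm{v}_{\mathfrak p}(I)$. Here $(I:f)=\{g\in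 S\mid gf\in I\}$. *)

theory Defs
  imports "HOL-Library.Poly_Mapping" "HOL-Algebra.Algebraic_Closure_Type"
begin

text \<open>
  A monomial is its exponent vector; the variables are indexed by a finite type
  whose cardinality plays the role of \<open>n\<close>.
  (For \<open>n = 0\<close> the ring is a field, which has no nonzero proper ideals.)
\<close>

type_synonym ('n, 'k) mpoly = "('n \<Rightarrow>\<^sub>0 nat) \<Rightarrow>\<^sub>0 'k"

abbreviation poly_ring :: "('n::finite, 'k::field) mpoly ring"
  where "poly_ring \<equiv> ring_of_type_algebra"

definition mon_deg :: "('n::finite \<Rightarrow>\<^sub>0 nat) \<Rightarrow> nat"
  where "mon_deg m = (\<Sum>i\<in>UNIV. Poly_Mapping.lookup m i)"

definition graded_part :: "nat \<Rightarrow> ('n::finite, 'k::field) mpoly set"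
  where "graded_part d = {f. \<forall>m\<in>Poly_Mapping.keys f. mon_deg m = d}"

definition hom_component :: "nat \<Rightarrow> ('n::finite, 'k::field) mpoly \<Rightarrow> ('n, 'k) mpoly"
  where "hom_component d f =
    (\<Sum>m\<in>{m \<in> Poly_Mapping.keys f. mon_deg m = d}. Poly_Mapping.single m (Poly_Mapping.lookup f m))"

definition graded_ideal :: "('n::finite, 'k::field) mpoly set \<Rightarrow> bool"
  where "graded_ideal I \<longleftrightarrow> ideal I poly_ring \<and> (\<forall>f\<in>I. \<forall>d. hom_component d f \<in> I)"

definition ideal_colon ::
    "('n::finite, 'k::field) mpoly set \<Rightarrow> ('n, 'k) mpoly \<Rightarrow> ('n, 'k) mpoly set"
  where "ideal_colon I f = {g. g * f \<in> I}"

text \<open>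
  The annihilator of the class of \<open>f\<close> in the module \<open>S/I\<close> is \<open>(I : f)\<close>; the
  associated primes are the prime ideals that arise as such annihilators.
  Here \<open>f\<close> need not be homogeneous.
\<close>

definition Ass :: "('n::finite, 'k::field) mpoly set \<Rightarrow> ('n, 'k) mpoly set set"
  where "Ass I = {p. primeideal p poly_ring \<and> (\<exists>f. ideal_colon I f = p)}"

definition initial_degree :: "('n::finite, 'k::field) mpoly set \<Rightarrow> nat"
  where "initial_degree I = (LEAST d. \<exists>f\<in>graded_part d. f \<in> I \<and> f \<noteq> 0)"

definition max_initial_degree_Ass :: "('n::finite, 'k::field) mpoly set \<Rightarrow> nat"
  where "max_initial_degree_Ass I = Max (initial_degree ` Ass I)"

definition local_v_number ::
    "('n::finite, 'k::field) mpoly set \<Rightarrow> ('n, 'k) mpoly set \<Rightarrow> nat"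
  where "local_v_number p I = (LEAST d. \<exists>f\<in>graded_part d. ideal_colon I f = p)"

definition v_number :: "('n::finite, 'k::field) mpoly set \<Rightarrow> nat"
  where "v_number I = (LEAST d. \<exists>f\<in>graded_part d. \<exists>p\<in>Ass I. ideal_colon I f = p)"

definition generated_by_linear_forms :: "('n::finite, 'k::field) mpoly set \<Rightarrow> bool"
  where "generated_by_linear_forms p \<longleftrightarrow> (\<exists>L. L \<subseteq> graded_part 1 \<and> p = Idl\<^bsub>poly_ring\<^esub> L)"

definition monomial_ideal :: "('n::finite, 'k::field) mpoly set \<Rightarrow> bool"
  where "monomial_ideal I \<longleftrightarrow>
    (\<exists>M. I = Idl\<^bsub>poly_ring\<^esub> ((\<lambda>m. Poly_Mapping.single m 1) ` M))"

end

theory Submission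
  imports Defs "HOL-Library.Countable"
begin

text \<open>
  The inequality is a degree count. Suppose that \<open>f\<close> is homogeneous of degree \<open>d\<close> with
  \<open>(I : f) = p\<close>, and let \<open>g \<noteq> 0\<close> be a homogeneous element of \<open>p\<close> of least degree. Since
  the polynomial ring is a domain, \<open>g * f\<close> is a nonzero homogeneous element of \<open>I\<close> of
  degree \<open>d + \<alpha>(p)\<close>, so \<open>\<alpha>(I) \<le> d + \<alpha>(p)\<close>
  (\<open>initial_degree_le_annihilated_degree\<close>). If \<open>p\<close> is generated by linear forms then
  \<open>\<alpha>(p) \<le> 1\<close>, because \<open>p\<close> contains \<open>I\<close> and so is not zero.

  This says something about the v-numbers only if their defining minima and maximum are
  attained, and that is where most of the work lies.

  \<^item> A prime of the form \<open>(I : f)\<close> with \<open>f\<close> arbitrary is also \<open>(I : h)\<close> for a homogeneous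
    component \<open>h\<close> of \<open>f\<close> (\<open>prime_annihilator_homogeneous\<close>); so every local v-number is
    attained.

  \<^item> A proper ideal has an associated prime (\<open>Ass_nonempty\<close>); so the v-number is attained.
    A maximal ideal among the \<open>(I : f)\<close> with \<open>f \<notin> I\<close> is prime, and it exists because the
    polynomial ring is Noetherian (\<open>no_ascending_chain_of_ideals\<close>), which follows from
    Dickson's lemma by comparing leading monomials.

  \<^item> The maximum \<open>c(I)\<close> is over a finite set: \<open>I \<subseteq> p\<close> gives \<open>\<alpha>(p) \<le> \<alpha>(I)\<close>, so only finitely
    many values occur.

  For a monomial ideal the argument about homogeneous components is repeated for a finer
  grading. All that it uses of the degree is that it is additive with values in an ordered
  cancellative monoid, so the gradings are treated in that generality. Grading by the
  exponent vector itself, ordered lexicographically, makes a monomial ideal graded, hence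
  also its associated primes: these are generated by monomials, and, being prime, by
  variables.
\<close>

section \<open>Ideals of the polynomial ring\<close>

lemma ideal_poly_ring_iff:
  fixes I :: "('n::finite, 'k::field) mpoly set"
  shows "ideal I poly_ring \<longleftrightarrow>
    0 \<in> I \<and> (\<forall>f\<in>I. \<forall>g\<in>I. f + g \<in> I) \<and> (\<forall>f\<in>I. \<forall>g. g * f \<in> I)"
proof
  assume "ideal I poly_ring"
  then interpret ideal I poly_ring .
  show "0 \<in> I \<and> (\<forall>f\<in>I. \<forall>g\<in>I. f + g \<in> I) \<and> (\<forall>f\<in>I. \<forall>g. g * f \<in> I)"
    using additive_subgroup.zero_closed[OF is_additive_subgroup]
      additive_subgroup.a_closed[OF is_additive_subgroup] I_l_closed
    by (simp add: ring_of_type_algebra_def)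
next
  assume I: "0 \<in> I \<and> (\<forall>f\<in>I. \<forall>g\<in>I. f + g \<in> I) \<and> (\<forall>f\<in>I. \<forall>g. g * f \<in> I)"
  interpret R: ring "poly_ring :: ('n, 'k) mpoly ring"
    by (rule ring_from_type_algebra)
  have minus: "\<ominus>\<^bsub>poly_ring\<^esub> f = - f" for f :: "('n, 'k) mpoly"
    by (rule R.minus_equality) (simp_all add: ring_of_type_algebra_def)
  have "- f \<in> I" if "f \<in> I" for f
    using I that by (metis mult_minus1)
  then have "subgroup I (add_monoid poly_ring)"
    using I minus by (intro subgroup.intro) (auto simp: ring_of_type_algebra_def a_inv_def)
  then show "ideal I poly_ring"
    using I by (intro idealI R.ring_axioms) (auto simp: ring_of_type_algebra_def mult.commute)
qed

context
  fixes I :: "('n::finite, 'k::field) mpoly set"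
  assumes I: "ideal I poly_ring"
begin

lemma ideal_zero: "0 \<in> I"
  and ideal_add: "f \<in> I \<Longrightarrow> g \<in> I \<Longrightarrow> f + g \<in> I"
  and ideal_mult_left: "f \<in> I \<Longrightarrow> g * f \<in> I"
  using I by (auto simp: ideal_poly_ring_iff)

lemma ideal_mult_right: "f \<in> I \<Longrightarrow> f * g \<in> I"
  using ideal_mult_left by (simp add: mult.commute)

lemma ideal_diff: "f \<in> I \<Longrightarrow> g \<in> I \<Longrightarrow> f - g \<in> I"
  using ideal_add[of f "- g"] ideal_mult_left[of g "- 1"] by simp

lemma ideal_sum: "(\<And>x. x \<in> A \<Longrightarrow> h x \<in> I) \<Longrightarrow> sum h A \<in> I"
  by (induction A rule: infinite_finite_induct) (auto intro: ideal_zero ideal_add)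

lemma ideal_one_iff: "1 \<in> I \<longleftrightarrow> I = UNIV"
  using ideal_mult_right[of 1] by auto

lemma ideal_ideal_colon: "ideal (ideal_colon I f) poly_ring"
  using ideal_zero ideal_add ideal_mult_left
  by (auto simp: ideal_poly_ring_iff ideal_colon_def distrib_right mult.assoc)

lemma ideal_subset_ideal_colon: "I \<subseteq> ideal_colon I f"
  using ideal_mult_right by (auto simp: ideal_colon_def)

end

lemma primeideal_poly_ring_iff:
  fixes p :: "('n::finite, 'k::field) mpoly set"
  shows "primeideal p poly_ring \<longleftrightarrow>
    ideal p poly_ring \<and> p \<noteq> UNIV \<and> (\<forall>f g. f * g \<in> p \<longrightarrow> f \<in> p \<or> g \<in> p)"
  (is "_ \<longleftrightarrow> ?rhs")
proof
  assume "primeideal p poly_ring"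
  then interpret primeideal p poly_ring .
  show ?rhs
    using is_ideal I_notcarr I_prime by (auto simp: ring_of_type_algebra_def)
next
  assume ?rhs
  then show "primeideal p poly_ring"
    by (intro primeidealI cring_from_type_algebra) (auto simp: ring_of_type_algebra_def)
qed

context
  fixes p :: "('n::finite, 'k::field) mpoly set"
  assumes p: "primeideal p poly_ring"
begin

lemma primeideal_ideal: "ideal p poly_ring"
  and primeideal_mult: "f * g \<in> p \<Longrightarrow> f \<in> p \<or> g \<in> p"
  and primeideal_one: "1 \<notin> p"
  using p ideal_one_iff[of p] by (auto simp: primeideal_poly_ring_iff)

lemma primeideal_power: "f ^ n \<in> p \<Longrightarrow> f \<in> p"
  using primeideal_one primeideal_mult by (induction n) auto

lemma primeideal_prod: "prod h A \<in> p \<Longrightarrow> finite A \<Longrightarrow> \<exists>x\<in>A. h x \<in> p"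
proof (induction A rule: infinite_finite_induct)
  case (insert x A)
  then show ?case
    using primeideal_mult[of "h x" "prod h A"] by auto
qed (auto simp: primeideal_one)

end

lemma ideal_genideal_poly_ring: "ideal (Idl\<^bsub>poly_ring\<^esub> (L :: ('n::finite, 'k::field) mpoly set)) poly_ring"
  by (rule ring.genideal_ideal) (auto simp: ring_of_type_algebra_def intro: ring_from_type_algebra[unfolded ring_of_type_algebra_def])

lemma genideal_poly_ring_superset: "L \<subseteq> Idl\<^bsub>poly_ring\<^esub> (L :: ('n::finite, 'k::field) mpoly set)"
  by (auto simp: genideal_def)

lemma genideal_poly_ring_minimal:
  "ideal J poly_ring \<Longrightarrow> L \<subseteq> J \<Longrightarrow> Idl\<^bsub>poly_ring\<^esub> (L :: ('n::finite, 'k::field) mpoly set) \<subseteq> J"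
  by (auto simp: genideal_def)


section \<open>Gradings by an ordered monoid\<close>

lemma poly_mapping_sum_terms:
  "(\<Sum>m\<in>Poly_Mapping.keys f. Poly_Mapping.single m (Poly_Mapping.lookup f m)) = f"
  by (rule poly_mapping_eqI) (auto simp: lookup_sum lookup_single when_def sum.delta in_keys_iff)

text \<open>
  Two gradings are used below: by total degree, and by the exponent vector ordered
  lexicographically. The order on the degrees singles out the top component of a product as
  the product of the top components.
\<close>

locale monomial_grading =
  fixes deg :: "('n::finite \<Rightarrow>\<^sub>0 nat) \<Rightarrow> 'd::{linorder, ordered_cancel_comm_monoid_add}"
  assumes deg_add: "deg (a + b) = deg a + deg b"
begin

definition component :: "'d \<Rightarrow> ('n, 'k::field) mpoly \<Rightarrow> ('n, 'k) mpoly"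
  where "component d f =
    (\<Sum>m\<in>{m \<in> Poly_Mapping.keys f. deg m = d}. Poly_Mapping.single m (Poly_Mapping.lookup f m))"

definition graded :: "('n, 'k::field) mpoly set \<Rightarrow> bool"
  where "graded I \<longleftrightarrow> (\<forall>f\<in>I. \<forall>d. component d f \<in> I)"

abbreviation support :: "('n, 'k::field) mpoly \<Rightarrow> 'd set"
  where "support f \<equiv> deg ` Poly_Mapping.keys f"

lemma lookup_component:
  "Poly_Mapping.lookup (component d f) m = (Poly_Mapping.lookup f m when deg m = d)"
  by (auto simp: component_def lookup_sum lookup_single when_def sum.delta in_keys_iff)

lemma keys_component: "Poly_Mapping.keys (component d f) = {m \<in> Poly_Mapping.keys f. deg m = d}"
  by (auto simp: in_keys_iff lookup_component when_def split: if_splits)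

lemma component_zero: "component d 0 = 0"
  by (simp add: component_def)

lemma component_add: "component d (f + g) = component d f + component d g"
  by (rule poly_mapping_eqI) (simp add: lookup_component lookup_add when_add_distrib)

lemma component_sum: "component d (sum h A) = (\<Sum>x\<in>A. component d (h x))"
  by (induction A rule: infinite_finite_induct) (auto simp: component_zero component_add)

lemma component_homogeneous:
  assumes "support f \<subseteq> {d}"
  shows "component x f = (if x = d then f else 0)"
proof (rule poly_mapping_eqI)
  fix m
  have "deg m = d" if "Poly_Mapping.lookup f m \<noteq> 0"
    using assms that by (auto simp: image_subset_iff in_keys_iff)
  then show "Poly_Mapping.lookup (component x f) m = Poly_Mapping.lookup (if x = d then f else 0) m"
    by (auto simp: lookup_component when_def)
qed

lemma component_eq_zero: "d \<notin> support f \<Longrightarrow> component d f = 0"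
  by (rule poly_mapping_eqI) (auto simp: lookup_component when_def in_keys_iff)

lemma support_component: "support (component d f) \<subseteq> {d}"
  by (auto simp: keys_component)

lemma support_diff_component: "support (f - component d f) = support f - {d}"
proof -
  have "Poly_Mapping.keys (f - component d f) = {m \<in> Poly_Mapping.keys f. deg m \<noteq> d}"
    by (auto simp: in_keys_iff lookup_component lookup_minus when_def)
  then show ?thesis by auto
qed

lemma sum_components: "(\<Sum>d\<in>support f. component d f) = f"
  by (rule poly_mapping_eqI) (auto simp: lookup_sum lookup_component when_def in_keys_iff)

lemma support_mult: "support (f * g) \<subseteq> {d + e |d e. d \<in> support f \<and> e \<in> support g}"
proof
  fix x assume "x \<in> support (f * g)"
  then obtain a b where "a \<in> Poly_Mapping.keys f" "b \<in> Poly_Mapping.keys g" "x = deg (a + b)"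
    using keys_mult[of f g] by blast
  then show "x \<in> {d + e |d e. d \<in> support f \<and> e \<in> support g}"
    using deg_add by blast
qed

lemma component_mult_homogeneous:
  assumes "support f \<subseteq> {d}"
  shows "component (d + e) (f * g) = f * component e g"
proof -
  have "component (d + e) (f * g) = (\<Sum>e'\<in>support g. component (d + e) (f * component e' g))"
    by (subst sum_components[of g, symmetric]) (simp only: sum_distrib_left component_sum)
  also have "\<dots> = (\<Sum>e'\<in>support g. if e' = e then f * component e g else 0)"
  proof (rule sum.cong)
    fix e' assume "e' \<in> support g"
    have "support (f * component e' g) \<subseteq> {d + e'}"
      using support_mult[of f "component e' g"] assms support_component[of e' g] by blast
    then show "component (d + e) (f * component e' g) = (if e' = e then f * component e g else 0)"
      using component_homogeneous[of f "d + e'"] by (simp add: component_homogeneous)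
  qed simp
  also have "\<dots> = f * component e g"
    using component_eq_zero[of e g] by (simp add: sum.delta)
  finally show ?thesis .
qed

text \<open>
  Replacing \<open>f\<close> by its top component only discards terms whose products with \<open>g\<close> have
  degree strictly below \<open>d + e\<close>.
\<close>

lemma component_mult_top:
  assumes "\<forall>x\<in>support f. x \<le> d" and "\<forall>x\<in>support g. x \<le> e"
  shows "component (d + e) (f * g) = component d f * component e g"
proof -
  have "component (d + e) ((f - component d f) * g) = 0"
  proof (rule component_eq_zero)
    show "d + e \<notin> support ((f - component d f) * g)"
    proof
      assume "d + e \<in> support ((f - component d f) * g)"
      then obtain x y where "d + e = x + y" "x \<in> support f - {d}" "y \<in> support g"
        using support_mult[of "f - component d f" g] by (auto simp: support_diff_component)
      then show False
        using assms add_less_le_mono[of x d y e] by fastforce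
    qed
  qed
  moreover have "f * g = component d f * g + (f - component d f) * g"
    by (simp add: algebra_simps)
  ultimately show ?thesis
    by (simp add: component_add component_mult_homogeneous[OF support_component])
qed


subsection \<open>Prime annihilators over a graded ideal\<close>

text \<open>
  Let \<open>h\<close> and \<open>t\<close> be the top components of \<open>g\<close> and \<open>f\<close>. The top component \<open>h * t\<close> of
  \<open>g * f\<close> lies in the graded ideal \<open>I\<close>. Hence \<open>h * (f - t)\<close> is again annihilated by \<open>g\<close>
  modulo \<open>I\<close>, and it has fewer components than \<open>f\<close>, so that induction applies to it.
\<close>

lemma top_component_power_annihilates:
  assumes I: "ideal I poly_ring" "graded I"
    and d: "\<forall>x\<in>support g. x \<le> d"
  shows "g * f \<in> I \<Longrightarrow> \<exists>n. component d g ^ n * f \<in> I"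
proof (induction "card (support f)" arbitrary: f rule: less_induct)
  case less
  show ?case
  proof (cases "f = 0")
    case True
    then show ?thesis using ideal_zero[OF I(1)] by simp
  next
    case False
    define e where "e = Max (support f)"
    have e: "e \<in> support f" "\<forall>x\<in>support f. x \<le> e"
      using False by (auto simp: e_def intro!: Max_in)
    let ?h = "component d g" and ?t = "component e f"
    have ht: "?h * ?t \<in> I"
      using I(2) less.prems component_mult_top[OF d e(2)] unfolding graded_def by metis
    let ?f = "?h * (f - ?t)"
    have "g * ?f = ?h * (g * f) - g * (?h * ?t)"
      by (simp add: algebra_simps)
    then have "g * ?f \<in> I"
      using I(1) less.prems ht by (simp add: ideal_diff ideal_mult_left)
    moreover have "card (support ?f) < card (support f)"
    proof -
      have "support ?f \<subseteq> (\<lambda>x. d + x) ` (support f - {e})"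
        using support_mult[of ?h "f - ?t"] support_component[of d g]
        by (fastforce simp: support_diff_component)
      then have "card (support ?f) \<le> card (support f - {e})"
        by (meson card_image_le card_mono finite_Diff finite_imageI finite_keys le_trans)
      also have "\<dots> < card (support f)"
        using e(1) by (intro psubset_card_mono) auto
      finally show ?thesis .
    qed
    ultimately obtain n where "?h ^ n * ?f \<in> I"
      using less.hyps by blast
    then have "?h ^ n * ?f + ?h ^ n * (?h * ?t) \<in> I"
      using I(1) ht by (simp add: ideal_add ideal_mult_left)
    moreover have "?h ^ n * ?f + ?h ^ n * (?h * ?t) = ?h ^ Suc n * f"
      by (simp add: algebra_simps)
    ultimately show ?thesis by metis
  qed
qed

text \<open>
  By the previous lemma and primality, \<open>p\<close> contains the top component of each of its
  elements. Subtracting it leaves an element of \<open>p\<close> with fewer components.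
\<close>

lemma graded_prime_annihilator:
  assumes I: "ideal I poly_ring" "graded I"
    and p: "primeideal p poly_ring" "ideal_colon I f = p"
  shows "graded p"
proof -
  have "\<forall>d. component d g \<in> p" if "g \<in> p" for g
    using that
  proof (induction "card (support g)" arbitrary: g rule: less_induct)
    case less
    show ?case
    proof (cases "g = 0")
      case True
      then show ?thesis
        using ideal_zero[OF primeideal_ideal[OF p(1)]] by (simp add: component_zero)
    next
      case False
      define d where "d = Max (support g)"
      have d: "d \<in> support g" "\<forall>x\<in>support g. x \<le> d"
        using False by (auto simp: d_def intro!: Max_in)
      obtain n where "component d g ^ n * f \<in> I"
        using top_component_power_annihilates[OF I d(2)] less.prems p(2)
        by (auto simp: ideal_colon_def)
      then have top: "component d g \<in> p"
        using p primeideal_power[OF p(1)] by (auto simp: ideal_colon_def)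
      let ?g = "g - component d g"
      have "?g \<in> p"
        using less.prems top ideal_diff[OF primeideal_ideal[OF p(1)]] by blast
      moreover have "card (support ?g) < card (support g)"
        using d(1) unfolding support_diff_component by (intro psubset_card_mono) auto
      ultimately have rest: "component x ?g \<in> p" for x
        using less.hyps by blast
      have "component x g = component x (component d g) + component x ?g" for x
        by (simp flip: component_add)
      moreover have "component x (component d g) \<in> p" for x
        using top ideal_zero[OF primeideal_ideal[OF p(1)]]
        by (simp add: component_homogeneous[OF support_component])
      ultimately show ?thesis
        using rest ideal_add[OF primeideal_ideal[OF p(1)]] by metis
    qed
  qed
  then show ?thesis by (simp add: graded_def)
qed

text \<open>
  As \<open>p\<close> and \<open>I\<close> are graded, \<open>p\<close> annihilates every component of \<open>f\<close> modulo \<open>I\<close>. If every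
  component were annihilated by something outside \<open>p\<close>, the product of these annihilators
  would annihilate \<open>f\<close>, so it would lie in \<open>p\<close>, against primality.
\<close>

theorem prime_annihilator_homogeneous:
  assumes I: "ideal I poly_ring" "graded I"
    and p: "primeideal p poly_ring" "ideal_colon I f = p"
  shows "\<exists>d. ideal_colon I (component d f) = p"
proof -
  have graded_p: "graded p"
    using graded_prime_annihilator[OF I p] .
  have sub: "p \<subseteq> ideal_colon I (component e f)" for e
  proof
    fix g assume "g \<in> p"
    have "component d g * component e f \<in> I" for d
    proof -
      have "component d g * f \<in> I"
        using graded_p \<open>g \<in> p\<close> p(2) by (auto simp: graded_def ideal_colon_def)
      then have "component (d + e) (component d g * f) \<in> I"
        using I(2) by (simp add: graded_def)
      then show ?thesis
        by (simp add: component_mult_homogeneous[OF support_component])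
    qed
    then have "(\<Sum>d\<in>support g. component d g * component e f) \<in> I"
      by (intro ideal_sum I(1))
    then show "g \<in> ideal_colon I (component e f)"
      by (simp add: ideal_colon_def sum_components flip: sum_distrib_right)
  qed
  have "\<exists>e\<in>support f. ideal_colon I (component e f) \<subseteq> p"
  proof (rule ccontr)
    assume "\<not> ?thesis"
    then have "\<forall>e\<in>support f. \<exists>h. h * component e f \<in> I \<and> h \<notin> p"
      by (auto simp: ideal_colon_def)
    then obtain h where h: "\<And>e. e \<in> support f \<Longrightarrow> h e * component e f \<in> I"
        "\<And>e. e \<in> support f \<Longrightarrow> h e \<notin> p"
      by metis
    \<comment> \<open>The product annihilates all components of \<open>f\<close>, hence \<open>f\<close> itself.\<close>
    let ?H = "prod h (support f)"
    have "?H * component e f \<in> I" if "e \<in> support f" for e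
    proof -
      have "?H * component e f = prod h (support f - {e}) * (h e * component e f)"
        using that by (simp add: prod.remove[of "support f" e] mult_ac)
      then show ?thesis
        using h(1)[OF that] I(1) by (simp add: ideal_mult_left)
    qed
    then have "(\<Sum>e\<in>support f. ?H * component e f) \<in> I"
      by (intro ideal_sum I(1))
    then have "?H \<in> p"
      using p(2) by (auto simp: ideal_colon_def sum_components simp flip: sum_distrib_left)
    then have "\<exists>e\<in>support f. h e \<in> p"
      by (rule primeideal_prod[OF p(1)]) simp
    then show False
      using h(2) by blast
  qed
  then show ?thesis using sub by blast
qed

end

interpretation degree: monomial_grading "mon_deg :: ('n::finite \<Rightarrow>\<^sub>0 nat) \<Rightarrow> nat"
  by standard (simp add: mon_deg_def lookup_add sum.distrib)

text \<open>
  The variables are indexed by an arbitrary finite type, which carries no order. Numbering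
  them embeds the monomials into exponent vectors over the natural numbers, whose order is lexicographic and
  compatible with addition. Comparing keys is thus a monomial order, and the homogeneous
  components of the corresponding grading are single terms.
\<close>

definition lex_key :: "('n::finite \<Rightarrow>\<^sub>0 nat) \<Rightarrow> (nat \<Rightarrow>\<^sub>0 nat)"
  where "lex_key m = (\<Sum>i\<in>UNIV. Poly_Mapping.single (to_nat i) (Poly_Mapping.lookup m i))"

lemma lookup_lex_key: "Poly_Mapping.lookup (lex_key m) (to_nat i) = Poly_Mapping.lookup m i"
  by (simp add: lex_key_def lookup_sum lookup_single when_def)

lemma lex_key_eq_iff: "lex_key a = lex_key b \<longleftrightarrow> a = b"
  by (metis lookup_lex_key poly_mapping_eqI)

interpretation lex: monomial_grading "lex_key :: ('n::finite \<Rightarrow>\<^sub>0 nat) \<Rightarrow> _"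
  by standard (simp add: lex_key_def lookup_add single_add sum.distrib)


section \<open>Leading monomials\<close>

lemma lex_component: "lex.component (lex_key m) f = Poly_Mapping.single m (Poly_Mapping.lookup f m)"
  by (rule poly_mapping_eqI) (auto simp: lex.lookup_component lookup_single when_def lex_key_eq_iff)

lemma lex_support_single: "lex.support (Poly_Mapping.single m c) \<subseteq> {lex_key m}"
  by (auto simp: keys_single split: if_splits)

text \<open>
  The coefficients of a term times \<open>f\<close> are read off in the lexicographic grading, where
  multiplication by a term shifts the components.
\<close>

lemma lookup_single_mult:
  fixes f :: "('n::finite, 'k::field) mpoly"
  shows "Poly_Mapping.lookup (Poly_Mapping.single t c * f) (t + m) = c * Poly_Mapping.lookup f m"
proof -
  have "lex.component (lex_key (t + m)) (Poly_Mapping.single t c * f) =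
      Poly_Mapping.single t c * lex.component (lex_key m) f"
    unfolding lex.deg_add by (rule lex.component_mult_homogeneous) (rule lex_support_single)
  then have "Poly_Mapping.single (t + m) (Poly_Mapping.lookup (Poly_Mapping.single t c * f) (t + m)) =
      Poly_Mapping.single (t + m) (c * Poly_Mapping.lookup f m)"
    by (simp add: lex_component mult_single)
  then show ?thesis
    by (metis lookup_single_eq)
qed

definition leading_monomial :: "('n::finite, 'k::field) mpoly \<Rightarrow> ('n \<Rightarrow>\<^sub>0 nat) \<Rightarrow> bool"
  where "leading_monomial f m \<longleftrightarrow>
    m \<in> Poly_Mapping.keys f \<and> (\<forall>a\<in>Poly_Mapping.keys f. lex_key a \<le> lex_key m)"

lemma leading_monomial_exists:
  assumes "f \<noteq> 0"
  shows "\<exists>m. leading_monomial f m"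
proof -
  have "Max (lex.support f) \<in> lex.support f"
    using assms by (intro Max_in) auto
  then obtain m where "m \<in> Poly_Mapping.keys f" "lex_key m = Max (lex.support f)"
    by auto
  then show ?thesis
    unfolding leading_monomial_def by (intro exI[of _ m]) auto
qed

text \<open>
  The product of the leading terms is the leading term of the product.
\<close>

lemma mpoly_mult_nonzero:
  fixes f g :: "('n::finite, 'k::field) mpoly"
  assumes "f \<noteq> 0" and "g \<noteq> 0"
  shows "f * g \<noteq> 0"
proof
  assume zero: "f * g = 0"
  obtain a b where a: "leading_monomial f a" and b: "leading_monomial g b"
    using leading_monomial_exists assms by blast
  have "lex.component (lex_key a + lex_key b) (f * g) =
      lex.component (lex_key a) f * lex.component (lex_key b) g"
    using a b by (intro lex.component_mult_top) (auto simp: leading_monomial_def)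
  then have "Poly_Mapping.single (a + b) (Poly_Mapping.lookup f a * Poly_Mapping.lookup g b) = 0"
    by (simp add: zero lex.component_zero lex_component mult_single)
  then have "Poly_Mapping.lookup f a * Poly_Mapping.lookup g b = 0"
    by (metis lookup_single_eq lookup_zero)
  then show False
    using a b by (auto simp: leading_monomial_def in_keys_iff)
qed


section \<open>The Hilbert basis theorem and existence of associated primes\<close>

text \<open>
  Every sequence has a monotone subsequence, and a decreasing sequence of natural numbers
  is constant from the point on where it takes its minimum.
\<close>

lemma mono_subsequence_nat:
  fixes s :: "nat \<Rightarrow> nat"
  shows "\<exists>r :: nat \<Rightarrow> nat. strict_mono r \<and> mono (\<lambda>k. s (r k))"
proof -
  obtain f :: "nat \<Rightarrow> nat" where f: "strict_mono f" "monoseq (\<lambda>k. s (f k))"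
    using seq_monosub[of s] by blast
  show ?thesis
  proof (cases "mono (\<lambda>k. s (f k))")
    case True
    then show ?thesis using f(1) by blast
  next
    case False
    then have dec: "s (f n) \<le> s (f m)" if "m \<le> n" for m n
      using f(2) that by (auto simp: monoseq_def mono_def)
    obtain N where N: "\<And>n. s (f N) \<le> s (f n)"
      using ex_has_least_nat[of "\<lambda>_. True" 0 "\<lambda>n. s (f n)"] by auto
    have "s (f (N + k)) = s (f N)" for k
      using dec[of N "N + k"] N[of "N + k"] by simp
    then have "mono (\<lambda>k. s (f (N + k)))"
      by (simp add: mono_def)
    moreover have "strict_mono (\<lambda>k. f (N + k))"
      using f(1) by (simp add: strict_mono_def)
    ultimately show ?thesis by blast
  qed
qed

text \<open>
  Thinning out the sequence once for each variable makes every exponent nondecreasing; then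
  the first monomial that is left divides the second one.
\<close>

lemma dickson:
  fixes s :: "nat \<Rightarrow> ('n::finite \<Rightarrow>\<^sub>0 nat)"
  shows "\<exists>i j t. i < j \<and> s j = s i + t"
proof -
  have "\<exists>r :: nat \<Rightarrow> nat. strict_mono r \<and> (\<forall>x\<in>A. mono (\<lambda>k. Poly_Mapping.lookup (s (r k)) x))"
    if "finite A" for A
    using that
  proof induction
    case empty
    show ?case by (rule exI[of _ id]) (simp add: strict_mono_def)
  next
    case (insert x A)
    then obtain r :: "nat \<Rightarrow> nat" where r: "strict_mono r"
        "\<forall>x\<in>A. mono (\<lambda>k. Poly_Mapping.lookup (s (r k)) x)"
      by blast
    obtain q :: "nat \<Rightarrow> nat" where q: "strict_mono q" "mono (\<lambda>k. Poly_Mapping.lookup (s (r (q k))) x)"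
      using mono_subsequence_nat[of "\<lambda>k. Poly_Mapping.lookup (s (r k)) x"] by blast
    have "mono (\<lambda>k. Poly_Mapping.lookup (s (r (q k))) y)" if "y \<in> A" for y
      using r(2) that q(1) by (auto simp: mono_def strict_mono_less_eq)
    then show ?case
      using r(1) q by (intro exI[of _ "\<lambda>k. r (q k)"]) (auto simp: strict_mono_def)
  qed
  from this[of UNIV] obtain r :: "nat \<Rightarrow> nat" where r: "strict_mono r"
      "\<And>x. mono (\<lambda>k. Poly_Mapping.lookup (s (r k)) x)"
    by auto
  have "s (r 1) = s (r 0) + (s (r 1) - s (r 0))"
    using r(2) by (intro poly_mapping_eqI) (simp add: lookup_add lookup_minus mono_def)
  moreover have "r 0 < r 1"
    using r(1) by (simp add: strict_mono_def)
  ultimately show ?thesis by blast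
qed

lemma lex_key_nonneg: "0 \<le> lex_key m"
proof -
  have "\<not> lex_key m < 0"
    by (simp add: less_poly_mapping.rep_eq less_fun_def)
  then show ?thesis by simp
qed

text \<open>
  In a descending sequence, some monomial would divide a later one by Dickson's lemma,
  although a divisor never exceeds a multiple in the lexicographic order.
\<close>

lemma wf_lex: "wf {(a, b :: 'n::finite \<Rightarrow>\<^sub>0 nat). lex_key a < lex_key b}"
proof -
  have False if dec: "\<And>i. lex_key (s (Suc i)) < lex_key (s i)" for s :: "nat \<Rightarrow> ('n \<Rightarrow>\<^sub>0 nat)"
  proof -
    obtain i j t where ij: "i < j" "s j = s i + t"
      using dickson by blast
    have "lex_key (s j) \<le> lex_key (s (Suc i))"
      by (rule lift_Suc_antimono_le[of "\<lambda>i. lex_key (s i)"]) (use less_imp_le[OF dec] ij(1) in simp_all)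
    also have "\<dots> < lex_key (s i)" by (rule dec)
    also have "\<dots> \<le> lex_key (s j)"
      using lex_key_nonneg[of t] by (simp add: ij(2) lex.deg_add add_increasing2)
    finally show False by simp
  qed
  then show ?thesis
    by (auto simp: wf_iff_no_infinite_down_chain)
qed

text \<open>
  From each difference \<open>J (Suc n) - J n\<close> pick an element \<open>G n\<close> whose leading monomial \<open>M n\<close>
  is least possible. By Dickson's lemma some \<open>M i\<close> divides a later \<open>M j\<close>. Cancelling the
  leading term of \<open>G j\<close> with a multiple of \<open>G i \<in> J j\<close> does not lead out of the difference
  \<open>J (Suc j) - J j\<close>, but it lowers the leading monomial.
\<close>

theorem no_ascending_chain_of_ideals:
  fixes J :: "nat \<Rightarrow> ('n::finite, 'k::field) mpoly set"
  assumes J: "\<And>n. ideal (J n) poly_ring" and strict: "\<And>n. J n \<subset> J (Suc n)"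
  shows False
proof -
  have "\<exists>g m. g \<in> J (Suc n) - J n \<and> leading_monomial g m \<and>
      (\<forall>h\<in>J (Suc n) - J n. \<forall>a. leading_monomial h a \<longrightarrow> \<not> lex_key a < lex_key m)" for n
  proof -
    let ?Q = "{m. \<exists>g\<in>J (Suc n) - J n. leading_monomial g m}"
    obtain g where "g \<in> J (Suc n) - J n"
      using strict[of n] by blast
    moreover from this have "g \<noteq> 0"
      using ideal_zero[OF J] by blast
    ultimately have "?Q \<noteq> {}"
      using leading_monomial_exists[of g] by blast
    then obtain m where "m \<in> ?Q" "\<And>a. lex_key a < lex_key m \<Longrightarrow> a \<notin> ?Q"
      using wfE_min'[OF wf_lex, of ?Q] by auto
    then show ?thesis by blast
  qed
  then obtain G M where G: "\<And>n. G n \<in> J (Suc n) - J n" and M: "\<And>n. leading_monomial (G n) (M n)"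
      and min: "\<And>n h a. h \<in> J (Suc n) - J n \<Longrightarrow> leading_monomial h a \<Longrightarrow> \<not> lex_key a < lex_key (M n)"
    by metis
  obtain i j t where ij: "i < j" and t: "M j = M i + t"
    using dickson[of M] by blast
  \<comment> \<open>With this factor, the multiple of \<open>G i\<close> has the same leading term as \<open>G j\<close>.\<close>
  define c where "c = Poly_Mapping.lookup (G j) (M j) / Poly_Mapping.lookup (G i) (M i)"
  let ?s = "Poly_Mapping.single t c * G i"
  let ?h = "G j - ?s"
  have "J (Suc i) \<subseteq> J j"
    by (rule lift_Suc_mono_le[of J]) (use strict ij in auto)
  then have s: "?s \<in> J j"
    using G[of i] J by (auto intro: ideal_mult_left)
  then have "?s \<in> J (Suc j)"
    using strict[of j] by blast
  then have "?h \<in> J (Suc j)"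
    using G[of j] by (auto intro: ideal_diff[OF J])
  moreover have "?h \<notin> J j"
    using G[of j] s ideal_add[OF J s, of ?h] by auto
  ultimately have h: "?h \<in> J (Suc j) - J j" by blast
  then have "?h \<noteq> 0"
    using ideal_zero[OF J[of j]] by auto
  then obtain m where m: "leading_monomial ?h m"
    using leading_monomial_exists by blast
  have "Poly_Mapping.lookup ?s (M j) = Poly_Mapping.lookup (G j) (M j)"
    using lookup_single_mult[of t c "G i" "M i"] M[of i]
    by (simp add: t add.commute c_def leading_monomial_def in_keys_iff)
  then have "m \<noteq> M j"
    using m by (auto simp: leading_monomial_def in_keys_iff lookup_minus)
  moreover have "lex_key m \<le> lex_key (M j)"
  proof (cases "m \<in> Poly_Mapping.keys (G j)")
    case True
    then show ?thesis using M[of j] by (simp add: leading_monomial_def)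
  next
    case False
    then have "m \<in> Poly_Mapping.keys ?s"
      using m by (auto simp: leading_monomial_def in_keys_iff lookup_minus)
    then obtain a where "a \<in> Poly_Mapping.keys (G i)" "m = t + a"
      using keys_mult[of "Poly_Mapping.single t c" "G i"] by (auto simp: keys_single split: if_splits)
    then show ?thesis
      using M[of i] add_right_mono[of "lex_key a" "lex_key (M i)" "lex_key t"]
      by (simp add: leading_monomial_def t lex.deg_add add.commute)
  qed
  ultimately have "lex_key m < lex_key (M j)"
    using lex_key_eq_iff[of m "M j"] by simp
  then show False
    using min[OF h m] by blast
qed

text \<open>
  Let \<open>(I : f)\<close> be maximal among the colon ideals of elements outside \<open>I\<close>. If
  \<open>g * h \<in> (I : f)\<close> and \<open>h \<notin> (I : f)\<close>, then \<open>h * f \<notin> I\<close> and \<open>(I : h * f) \<supseteq> (I : f)\<close>, so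
  both are equal by maximality, and \<open>g\<close> lies in the first.
\<close>

theorem Ass_nonempty:
  fixes I :: "('n::finite, 'k::field) mpoly set"
  assumes I: "ideal I poly_ring" and "I \<noteq> UNIV"
  shows "Ass I \<noteq> {}"
proof -
  \<comment> \<open>A pair in \<open>?r\<close> lists the larger ideal first, so that a minimal element is a maximal ideal.\<close>
  let ?r = "{(J', J :: ('n, 'k) mpoly set). ideal J poly_ring \<and> ideal J' poly_ring \<and> J \<subset> J'}"
  have "wf ?r"
    unfolding wf_iff_no_infinite_down_chain
  proof
    assume "\<exists>J. \<forall>n. (J (Suc n), J n) \<in> ?r"
    then obtain J where "\<And>n. (J (Suc n), J n) \<in> ?r"
      by blast
    then show False
      by (intro no_ascending_chain_of_ideals[of J]) simp_all
  qed
  moreover have "ideal_colon I 1 \<in> ideal_colon I ` (- I)"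
    using assms ideal_one_iff by blast
  ultimately obtain p where p: "p \<in> ideal_colon I ` (- I)"
      and max: "\<And>J. (J, p) \<in> ?r \<Longrightarrow> J \<notin> ideal_colon I ` (- I)"
    by (rule wfE_min) (rule that)
  from p obtain f where f: "f \<notin> I" "p = ideal_colon I f"
    by blast
  have "primeideal p poly_ring"
    unfolding primeideal_poly_ring_iff
  proof (intro conjI allI impI)
    show "ideal p poly_ring"
      unfolding f(2) by (rule ideal_ideal_colon[OF I])
    have "1 \<notin> p"
      using f by (simp add: ideal_colon_def)
    then show "p \<noteq> UNIV" by blast
    fix g h assume gh: "g * h \<in> p"
    show "g \<in> p \<or> h \<in> p"
    proof (rule disjCI)
      assume "h \<notin> p"
      then have "h * f \<notin> I"
        by (simp add: f(2) ideal_colon_def)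
      moreover have "p \<subseteq> ideal_colon I (h * f)"
        using ideal_mult_left[OF I] by (auto simp: f(2) ideal_colon_def mult.left_commute[of _ h])
      ultimately have "p = ideal_colon I (h * f)"
        using max[of "ideal_colon I (h * f)"] \<open>ideal p poly_ring\<close> ideal_ideal_colon[OF I]
        by blast
      moreover have "g \<in> ideal_colon I (h * f)"
        using gh by (simp add: f(2) ideal_colon_def mult.assoc)
      ultimately show "g \<in> p" by simp
    qed
  qed
  then show ?thesis
    using f by (auto simp: Ass_def)
qed


section \<open>Associated primes of monomial ideals\<close>

lemma monomial_ideal_lex_graded:
  fixes I :: "('n::finite, 'k::field) mpoly set"
  assumes "monomial_ideal I"
  shows "ideal I poly_ring" and "lex.graded I"
proof -
  obtain M where M: "I = Idl\<^bsub>poly_ring\<^esub> ((\<lambda>m. Poly_Mapping.single m 1) ` M)"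
    using assms by (auto simp: monomial_ideal_def)
  show I: "ideal I poly_ring"
    unfolding M by (rule ideal_genideal_poly_ring)
  \<comment> \<open>The polynomials all of whose monomials lie in \<open>I\<close> form an ideal containing the generators.\<close>
  let ?T = "{f :: ('n, 'k) mpoly. \<forall>m\<in>Poly_Mapping.keys f. Poly_Mapping.single m 1 \<in> I}"
  have "ideal ?T poly_ring"
    unfolding ideal_poly_ring_iff
  proof (intro conjI ballI allI)
    fix f g :: "('n, 'k) mpoly" assume f: "f \<in> ?T"
    show "g * f \<in> ?T"
    proof (rule CollectI, rule ballI)
      fix m assume "m \<in> Poly_Mapping.keys (g * f)"
      then obtain a b where "m = a + b" "b \<in> Poly_Mapping.keys f"
        using keys_mult[of g f] by blast
      then show "Poly_Mapping.single m 1 \<in> I"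
        using f ideal_mult_left[OF I, of "Poly_Mapping.single b 1" "Poly_Mapping.single a 1"]
        by (simp add: mult_single)
    qed
  next
    fix f g :: "('n, 'k) mpoly" assume "f \<in> ?T" "g \<in> ?T"
    then show "f + g \<in> ?T"
      using Poly_Mapping.keys_add[of f g] by blast
  qed simp
  moreover have "(\<lambda>m. Poly_Mapping.single m 1) ` M \<subseteq> ?T"
    using genideal_poly_ring_superset[of "(\<lambda>m. Poly_Mapping.single m 1) ` M"] unfolding M
    by (auto simp: image_subset_iff)
  ultimately have T: "I \<subseteq> ?T"
    unfolding M by (rule genideal_poly_ring_minimal)
  show "lex.graded I"
    unfolding lex.graded_def
  proof (intro ballI allI)
    fix f d assume "f \<in> I"
    have "Poly_Mapping.single m (Poly_Mapping.lookup f m) \<in> I" if "m \<in> Poly_Mapping.keys f" for m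
      using T \<open>f \<in> I\<close> that
        ideal_mult_left[OF I, of "Poly_Mapping.single m 1" "Poly_Mapping.single 0 (Poly_Mapping.lookup f m)"]
      by (auto simp: mult_single)
    then show "lex.component d f \<in> I"
      unfolding lex.component_def by (intro ideal_sum[OF I]) simp
  qed
qed

text \<open>
  A monomial is a product of variables, and a prime containing a product contains a factor.
\<close>

lemma prime_contains_variable_of_monomial:
  fixes p :: "('n::finite, 'k::field) mpoly set"
  assumes p: "primeideal p poly_ring"
  shows "Poly_Mapping.single m 1 \<in> p \<Longrightarrow>
    \<exists>i t. m = Poly_Mapping.single i 1 + t \<and> Poly_Mapping.single (Poly_Mapping.single i 1) 1 \<in> p"
proof (induction "mon_deg m" arbitrary: m rule: less_induct)
  case less
  have "m \<noteq> 0"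
    using less.prems primeideal_one[OF p] by auto
  then obtain i where i: "Poly_Mapping.lookup m i \<noteq> 0"
    by (metis lookup_zero poly_mapping_eqI)
  define t where "t = m - Poly_Mapping.single i 1"
  have m: "m = Poly_Mapping.single i 1 + t"
    using i by (intro poly_mapping_eqI) (auto simp: t_def lookup_add lookup_minus lookup_single when_def)
  then have "Poly_Mapping.single m (1 :: 'k) =
      Poly_Mapping.single (Poly_Mapping.single i 1) 1 * Poly_Mapping.single t 1"
    by (simp add: mult_single)
  then consider "Poly_Mapping.single (Poly_Mapping.single i 1) 1 \<in> p" | "Poly_Mapping.single t 1 \<in> p"
    using less.prems primeideal_mult[OF p] by metis
  then show ?case
  proof cases
    case 1
    then show ?thesis using m by blast
  next
    case 2
    have "mon_deg t < mon_deg m"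
      unfolding m degree.deg_add by (simp add: mon_deg_def lookup_single when_def)
    then obtain j u where "t = Poly_Mapping.single j 1 + u"
        "Poly_Mapping.single (Poly_Mapping.single j 1) 1 \<in> p"
      using less.hyps 2 by blast
    then show ?thesis
      using m by (metis add.left_commute)
  qed
qed

text \<open>
  The prime \<open>p\<close> is graded by exponent vectors, so it contains every term of each of its
  elements, and each such term is a multiple of a variable in \<open>p\<close>.
\<close>

theorem Ass_monomial_ideal_generated_by_linear_forms:
  fixes I :: "('n::finite, 'k::field) mpoly set"
  assumes "monomial_ideal I" and "p \<in> Ass I"
  shows "generated_by_linear_forms p"
proof -
  obtain f where p: "primeideal p poly_ring" and f: "ideal_colon I f = p"
    using assms(2) by (auto simp: Ass_def)
  have graded: "lex.graded p"
    using lex.graded_prime_annihilator[OF monomial_ideal_lex_graded[OF assms(1)] p f] .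
  define indet where "indet i = (Poly_Mapping.single (Poly_Mapping.single i 1) 1 :: ('n, 'k) mpoly)" for i
  define L where "L = p \<inter> range indet"
  have "p \<subseteq> Idl\<^bsub>poly_ring\<^esub> L"
  proof
    fix g assume "g \<in> p"
    have "Poly_Mapping.single m (Poly_Mapping.lookup g m) \<in> Idl\<^bsub>poly_ring\<^esub> L"
      if "m \<in> Poly_Mapping.keys g" for m
    proof -
      let ?c = "Poly_Mapping.lookup g m"
      have "Poly_Mapping.single m ?c \<in> p"
        using graded \<open>g \<in> p\<close> lex_component[of m g] unfolding lex.graded_def by metis
      then have "Poly_Mapping.single 0 (1 / ?c) * Poly_Mapping.single m ?c \<in> p"
        by (rule ideal_mult_left[OF primeideal_ideal[OF p]])
      then have "Poly_Mapping.single m 1 \<in> p"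
        using that by (simp add: mult_single in_keys_iff)
      then obtain i t where m: "m = Poly_Mapping.single i 1 + t" and "indet i \<in> p"
        using prime_contains_variable_of_monomial[OF p] unfolding indet_def by blast
      then have "indet i \<in> Idl\<^bsub>poly_ring\<^esub> L"
        using genideal_poly_ring_superset[of L] by (auto simp: L_def)
      moreover have "Poly_Mapping.single m ?c = indet i * Poly_Mapping.single t ?c"
        by (simp add: indet_def mult_single m)
      ultimately show ?thesis
        using ideal_mult_right[OF ideal_genideal_poly_ring] by metis
    qed
    then have "(\<Sum>m\<in>Poly_Mapping.keys g. Poly_Mapping.single m (Poly_Mapping.lookup g m)) \<in> Idl\<^bsub>poly_ring\<^esub> L"
      by (intro ideal_sum[OF ideal_genideal_poly_ring])
    then show "g \<in> Idl\<^bsub>poly_ring\<^esub> L"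
      by (simp only: poly_mapping_sum_terms)
  qed
  moreover have "Idl\<^bsub>poly_ring\<^esub> L \<subseteq> p"
    by (rule genideal_poly_ring_minimal[OF primeideal_ideal[OF p]]) (simp add: L_def)
  moreover have "L \<subseteq> graded_part 1"
    by (auto simp: L_def indet_def graded_part_def keys_single mon_deg_def lookup_single when_def)
  ultimately show ?thesis
    unfolding generated_by_linear_forms_def by blast
qed


section \<open>Initial degrees and v-numbers\<close>

lemma graded_part_iff: "f \<in> graded_part d \<longleftrightarrow> degree.support f \<subseteq> {d}"
  by (auto simp: graded_part_def)

lemma hom_component_eq: "hom_component = degree.component"
  by (intro ext) (simp add: hom_component_def degree.component_def)

lemma graded_part_mult:
  assumes "f \<in> graded_part d" and "g \<in> graded_part e"
  shows "f * g \<in> graded_part (d + e)"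
  using degree.support_mult[of f g] assms unfolding graded_part_iff by blast

lemma initial_degree_le:
  "f \<in> graded_part d \<Longrightarrow> f \<in> I \<Longrightarrow> f \<noteq> 0 \<Longrightarrow> initial_degree I \<le> d"
  unfolding initial_degree_def by (intro Least_le) blast

lemma initial_degree_attained:
  assumes "f \<in> graded_part d" "f \<in> I" "f \<noteq> 0"
  shows "\<exists>g\<in>graded_part (initial_degree I). g \<in> I \<and> g \<noteq> 0"
  unfolding initial_degree_def
  by (rule LeastI[of "\<lambda>d. \<exists>g\<in>graded_part d. g \<in> I \<and> g \<noteq> 0" d]) (use assms in blast)

context
  fixes I :: "('n::finite, 'k::field) mpoly set"
  assumes graded: "graded_ideal I" and nonzero: "I \<noteq> {0}"
begin

lemma graded_ideal_ideal: "ideal I poly_ring"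
  using graded by (simp add: graded_ideal_def)

lemma graded_ideal_homogeneous_element: "\<exists>d. \<exists>f\<in>graded_part d. f \<in> I \<and> f \<noteq> 0"
proof -
  obtain f where f: "f \<in> I" "f \<noteq> 0"
    using nonzero ideal_zero[OF graded_ideal_ideal] by blast
  then obtain m where m: "m \<in> Poly_Mapping.keys f"
    using keys_eq_empty[of f] by blast
  let ?g = "degree.component (mon_deg m) f"
  have "m \<in> Poly_Mapping.keys ?g"
    using m by (simp add: degree.keys_component)
  then have "?g \<noteq> 0" by auto
  moreover have "?g \<in> I"
    using graded f(1) by (simp add: graded_ideal_def hom_component_eq)
  moreover have "?g \<in> graded_part (mon_deg m)"
    unfolding graded_part_iff by (rule degree.support_component)
  ultimately show ?thesis by blast
qed

lemma Ass_superset: "p \<in> Ass I \<Longrightarrow> I \<subseteq> p"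
  using ideal_subset_ideal_colon[OF graded_ideal_ideal] by (auto simp: Ass_def)

lemma initial_degree_Ass_le:
  assumes "p \<in> Ass I"
  shows "initial_degree p \<le> initial_degree I"
proof -
  obtain f where "f \<in> graded_part (initial_degree I)" "f \<in> I" "f \<noteq> 0"
    using graded_ideal_homogeneous_element initial_degree_attained by blast
  then show ?thesis
    using Ass_superset[OF assms] by (intro initial_degree_le[of f]) auto
qed

lemma initial_degree_Ass_attained:
  assumes "p \<in> Ass I"
  shows "\<exists>g\<in>graded_part (initial_degree p). g \<in> p \<and> g \<noteq> 0"
proof -
  obtain d f where "f \<in> graded_part d" "f \<in> I" "f \<noteq> 0"
    using graded_ideal_homogeneous_element by blast
  then show ?thesis
    using Ass_superset[OF assms] by (intro initial_degree_attained[of f d]) auto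
qed

text \<open>
  Multiply \<open>f\<close> by a homogeneous element of \<open>p\<close> of least degree: the product lies in \<open>I\<close>,
  and it is not zero because the polynomial ring is a domain.
\<close>

lemma initial_degree_le_annihilated_degree:
  assumes "p \<in> Ass I" "f \<in> graded_part d" "ideal_colon I f = p"
  shows "initial_degree I \<le> d + initial_degree p"
proof -
  obtain g where g: "g \<in> graded_part (initial_degree p)" "g \<in> p" "g \<noteq> 0"
    using initial_degree_Ass_attained[OF assms(1)] by blast
  have "primeideal p poly_ring"
    using assms(1) by (simp add: Ass_def)
  then have "1 \<notin> p"
    by (rule primeideal_one)
  then have "f \<noteq> 0"
    using assms(3) ideal_zero[OF graded_ideal_ideal] by (auto simp: ideal_colon_def)
  then have "g * f \<noteq> 0"
    using g(3) by (rule mpoly_mult_nonzero[rotated])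
  moreover have "g * f \<in> I"
    using g(2) assms(3) by (auto simp: ideal_colon_def)
  moreover have "g * f \<in> graded_part (initial_degree p + d)"
    using g(1) assms(2) by (rule graded_part_mult)
  ultimately show ?thesis
    using initial_degree_le by (metis add.commute)
qed

text \<open>
  An associated prime comes with an arbitrary \<open>f\<close>; passing to a homogeneous component of
  \<open>f\<close> shows that the set of degrees whose minimum defines the local v-number is nonempty.
\<close>

lemma local_v_number_attained:
  assumes "p \<in> Ass I"
  shows "\<exists>f\<in>graded_part (local_v_number p I). ideal_colon I f = p"
proof -
  obtain f where p: "primeideal p poly_ring" and f: "ideal_colon I f = p"
    using assms by (auto simp: Ass_def)
  have "degree.graded I"
    using graded by (simp add: graded_ideal_def degree.graded_def hom_component_eq)
  then obtain d where "ideal_colon I (degree.component d f) = p"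
    using degree.prime_annihilator_homogeneous[OF graded_ideal_ideal _ p f] by blast
  moreover have "degree.component d f \<in> graded_part d"
    unfolding graded_part_iff by (rule degree.support_component)
  ultimately have "\<exists>f\<in>graded_part d. ideal_colon I f = p" by blast
  then show ?thesis
    unfolding local_v_number_def by (rule LeastI)
qed

lemma v_number_le_local_v_number: "p \<in> Ass I \<Longrightarrow> v_number I \<le> local_v_number p I"
  unfolding v_number_def using local_v_number_attained by (intro Least_le) blast

lemma v_number_attained:
  assumes "I \<noteq> UNIV"
  shows "\<exists>f\<in>graded_part (v_number I). \<exists>p\<in>Ass I. ideal_colon I f = p"
proof -
  obtain p where "p \<in> Ass I"
    using Ass_nonempty[OF graded_ideal_ideal assms] by blast
  then have "\<exists>d. \<exists>f\<in>graded_part d. \<exists>p\<in>Ass I. ideal_colon I f = p"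
    using local_v_number_attained by blast
  then show ?thesis
    unfolding v_number_def by (rule LeastI_ex)
qed

lemma initial_degree_le_max_initial_degree_Ass:
  assumes "p \<in> Ass I"
  shows "initial_degree p \<le> max_initial_degree_Ass I"
proof -
  have "finite (initial_degree ` Ass I)"
    by (rule finite_subset[of _ "{..initial_degree I}"]) (use initial_degree_Ass_le in auto)
  then show ?thesis
    using assms by (simp add: max_initial_degree_Ass_def)
qed

lemma initial_degree_Ass_linear_forms:
  assumes "p \<in> Ass I" and "generated_by_linear_forms p"
  shows "initial_degree p \<le> 1"
proof -
  obtain L where L: "L \<subseteq> graded_part 1" "p = Idl\<^bsub>poly_ring\<^esub> L"
    using assms(2) by (auto simp: generated_by_linear_forms_def)
  have "\<exists>l\<in>L. l \<noteq> 0"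
  proof (rule ccontr)
    assume "\<not> ?thesis"
    then have "p \<subseteq> {0}"
      unfolding L(2) by (intro genideal_poly_ring_minimal) (auto simp: ideal_poly_ring_iff)
    then show False
      using initial_degree_Ass_attained[OF assms(1)] by blast
  qed
  then show ?thesis
    using initial_degree_le L genideal_poly_ring_superset[of L] by blast
qed

end

theorem lemma3p1:
  fixes I :: "('n::finite, 'k::field) mpoly set"
  assumes "graded_ideal I" and "I \<noteq> {0}" and "I \<noteq> UNIV"
  shows "(\<forall>p\<in>Ass I. int (local_v_number p I) \<ge> int (initial_degree I) - int (initial_degree p))
    \<and> int (v_number I) \<ge> int (initial_degree I) - int (max_initial_degree_Ass I)
    \<and> ((\<forall>p\<in>Ass I. generated_by_linear_forms p) \<longrightarrow>
         (\<forall>p\<in>Ass I. local_v_number p I \<ge> v_number I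
            \<and> int (v_number I) \<ge> int (initial_degree I) - 1))
    \<and> (monomial_ideal I \<longrightarrow> (\<forall>p\<in>Ass I. generated_by_linear_forms p))"
proof (intro conjI)
  show "\<forall>p\<in>Ass I. int (local_v_number p I) \<ge> int (initial_degree I) - int (initial_degree p)"
  proof
    fix p assume p: "p \<in> Ass I"
    then have "initial_degree I \<le> local_v_number p I + initial_degree p"
      using local_v_number_attained[OF assms(1,2) p]
        initial_degree_le_annihilated_degree[OF assms(1,2) p] by blast
    then show "int (local_v_number p I) \<ge> int (initial_degree I) - int (initial_degree p)"
      by linarith
  qed
  obtain q where q: "q \<in> Ass I" "initial_degree I \<le> v_number I + initial_degree q"
    using v_number_attained[OF assms] initial_degree_le_annihilated_degree[OF assms(1,2)] by blast
  show "int (v_number I) \<ge> int (initial_degree I) - int (max_initial_degree_Ass I)"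
    using q initial_degree_le_max_initial_degree_Ass[OF assms(1,2) q(1)] by linarith
  show "(\<forall>p\<in>Ass I. generated_by_linear_forms p) \<longrightarrow>
      (\<forall>p\<in>Ass I. local_v_number p I \<ge> v_number I
        \<and> int (v_number I) \<ge> int (initial_degree I) - 1)"
  proof (intro impI ballI conjI)
    fix p assume linear: "\<forall>p\<in>Ass I. generated_by_linear_forms p" and "p \<in> Ass I"
    then show "v_number I \<le> local_v_number p I"
      using v_number_le_local_v_number[OF assms(1,2)] by blast
    have "initial_degree q \<le> 1"
      using initial_degree_Ass_linear_forms[OF assms(1,2) q(1)] linear q(1) by blast
    then show "int (v_number I) \<ge> int (initial_degree I) - 1"
      using q(2) by linarith
  qed
  show "monomial_ideal I \<longrightarrow> (\<forall>p\<in>Ass I. generated_by_linear_forms p)"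
    using Ass_monomial_ideal_generated_by_linear_forms by blast
qed

end
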